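(* Suppose that $t_*^1\in\mathbb V^1$ is a zero of $\mathcal A^1$, and let $\kappa=\|t_*^\perp\|_{\mathbb V}$. Assume the following. (i) $\mathcal A^j:\mathbb V^j\to(\mathbb V^j)^*$ is $C^1$ for $j=0,1$. (ii) $L^0\kappa=\sup_{u^0\in\mathbb V^0,\ \|u^0\|_{\mathbb V}=1}\langle\mathcal A^0(t_*^0)-\mathcal A^1(t_*^1),u^0\rangle$ for some $L^0<\infty$. (iii) For $j=0,1$, $\mathcal A^j$ is strongly monotone in $B_{\mathbb V^j}(t_*^j,\delta_j)$ with constant $C_{\mathrm{SM}}^j=C_{\mathrm{SM}}^j(\delta_j)>0$, i.e. $\langle\mathcal A^j(t)-\mathcal A^j(s),t-s\rangle\ge C^j_{\mathrm{SM}}\|t-s\|_{\mathbb V}^2$ for all $t,s\in B_{\mathbb V^j}(t_*^j,\delta_j)$. (iv) $\kappa<\delta\,\dfrac{C_{\mathrm{SM}}^0}{L^0}$, where $\delta=\min\{\delta_0,\delta_1\}$. Then there exists a unique $t_{**}^0\in B_{\mathbb V^0}(t_*^0,\delta)$ such that $\mathcal A^0(t_{**}^0)=0$. Furthermore, with $t_{**}^1=t_{**}^0+t_*^\perp$ and with $\mathcal K_{\mathrm L}$ the linear homotopy with parameters $\alpha=C_{\mathrm{SM}}^0$ and $u^\perp=t_*^\perp$, one has $i(\mathcal K_{\mathrm L}(\cdot,0),t_{**}^1)=i(\mathcal A^0,t_{**}^0)=1$.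
   Context: $\mathbb V^1$ is a finite-dimensional real inner product space with inner product $\langle\cdot,\cdot\rangle_{\mathbb V}$ and norm $\|\cdot\|_{\mathbb V}$ (in the paper, an amplitude space of coupled-cluster theory), $\mathbb V^0\subset\mathbb V^1$ is a subspace, and $(\mathbb V^0)^\perp$ is its $\langle\cdot,\cdot\rangle_{\mathbb V}$-orthogonal complement. Every $t^1\in\mathbb V^1$ is written uniquely $t^1=t^0+t^\perp$ with $t^0\in\mathbb V^0$, $t^\perp\in(\mathbb V^0)^\perp$; in particular $t_*^1=t_*^0+t_*^\perp$. $\mathcal A^j:\mathbb V^j\to(\mathbb V^j)^*$ ($j=0,1$) are continuous mappings; $\langle\cdot,\cdot\rangle$ denotes the duality pairing, and $B_{\mathbb V^j}(a,r)$ the open ball in $\mathbb V^j$. The linear homotopy $\mathcal K_{\mathrm L}:\mathbb V^1\times[0,1]\to(\mathbb V^1)^*$ with parameters $\alpha>0$, $u^\perp\in(\mathbb V^0)^\perp$ is $$\langle\mathcal K_{\mathrm L}(t^1,\lambda),s^1\rangle=(1-\lambda)\big(\langle\mathcal A^0(t^0),s^0\rangle+\alpha\langle t^\perp-u^\perp,s^\perp\rangle_{\mathbb V}\big)+\lambda\langle\mathcal A^1(t^1),s^1\rangle .$$ For an isolated zero $u$ of a continuous map $\mathcal F$ from a finite-dimensional space to its dual, $i(\mathcal F,u)=\deg(\mathcal F,B(u,r),0)$ (Brouwer degree, $r>0$ small), where the space and its dual are compatibly oriented (the dual basis of a positive basis is positive). *)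

theory Defs
  imports "HOL-Analysis.Analysis" "HOL-Homology.Homology"
begin

section \<open>Subspaces and their duals\<close>

definition orth_proj :: "'a::euclidean_space set \<Rightarrow> 'a \<Rightarrow> 'a" where
  "orth_proj E t = (THE y. y \<in> E \<and> t - y \<in> E\<^sup>\<bottom>)"

text \<open>The dual of a subspace \<open>E\<close>: a functional on \<open>E\<close> is represented by its unique extension to the
  whole space that vanishes on the orthogonal complement of \<open>E\<close>. This is an isometric isomorphism of
  the dual of \<open>E\<close> onto \<open>dual_space E\<close>, and \<open>dual_space UNIV = UNIV\<close>.\<close>

definition dual_space :: "'a::euclidean_space set \<Rightarrow> ('a \<Rightarrow>\<^sub>L real) set" where
  "dual_space E = {f. \<forall>s \<in> E\<^sup>\<bottom>. blinfun_apply f s = 0}"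

definition C1_on :: "'a::real_normed_vector set \<Rightarrow> ('a \<Rightarrow> 'b::real_normed_vector) \<Rightarrow> bool" where
  "C1_on E F \<longleftrightarrow> (\<exists>D :: 'a \<Rightarrow> 'a \<Rightarrow>\<^sub>L 'b. continuous_on E D \<and>
     (\<forall>x\<in>E. (F has_derivative blinfun_apply (D x)) (at x within E)))"

definition strongly_monotone_on ::
    "'a::euclidean_space set \<Rightarrow> ('a \<Rightarrow> 'a \<Rightarrow>\<^sub>L real) \<Rightarrow> real \<Rightarrow> bool" where
  "strongly_monotone_on S F C \<longleftrightarrow>
     (\<forall>t\<in>S. \<forall>s\<in>S. blinfun_apply (F t - F s) (t - s) \<ge> C * (norm (t - s))\<^sup>2)"


section \<open>The linear homotopy\<close>

definition linear_homotopy ::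
    "'a::euclidean_space set \<Rightarrow> ('a \<Rightarrow> 'a \<Rightarrow>\<^sub>L real) \<Rightarrow> ('a \<Rightarrow> 'a \<Rightarrow>\<^sub>L real) \<Rightarrow> real \<Rightarrow> 'a
      \<Rightarrow> 'a \<Rightarrow> real \<Rightarrow> 'a \<Rightarrow>\<^sub>L real" where
  "linear_homotopy V0 A0 A1 \<alpha> u t l = Blinfun (\<lambda>s.
     (1 - l) * (blinfun_apply (A0 (orth_proj V0 t)) (orth_proj V0 s)
                + \<alpha> * inner (t - orth_proj V0 t - u) (s - orth_proj V0 s))
     + l * blinfun_apply (A1 t) s)"


section \<open>Brouwer degree on balls and index of an isolated zero\<close>

definition orthonormal_frame :: "'a::euclidean_space set \<Rightarrow> (nat \<Rightarrow> 'a) \<Rightarrow> bool" where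
  "orthonormal_frame E b \<longleftrightarrow>
     (\<forall>i<dim E. \<forall>j<dim E. inner (b i) (b j) = (if i = j then 1 else 0)) \<and>
     span (b ` {..<dim E}) = E"

text \<open>The map \<open>x \<mapsto> F(u + r x) / |F(u + r x)|\<close> from the unit sphere to itself. Points of \<open>E\<close> are
  written in coordinates with respect to the basis \<open>b\<close>, functionals on \<open>E\<close> in coordinates with
  respect to the dual basis; these are given by evaluation at the \<open>b i\<close>. Using the basis together
  with its dual basis implements the compatible orientation of \<open>E\<close> and its dual.\<close>

definition sphere_map ::
    "'a::euclidean_space set \<Rightarrow> (nat \<Rightarrow> 'a) \<Rightarrow> ('a \<Rightarrow> 'a \<Rightarrow>\<^sub>L real) \<Rightarrow> 'a \<Rightarrow> real
      \<Rightarrow> (nat \<Rightarrow> real) \<Rightarrow> nat \<Rightarrow> real" where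
  "sphere_map E b F u r x =
     (let f = F (u + r *\<^sub>R (\<Sum>i<dim E. x i *\<^sub>R b i))
      in (\<lambda>j. if j < dim E
             then blinfun_apply f (b j) / L2_set (\<lambda>k. blinfun_apply f (b k)) {..<dim E}
             else 0))"

text \<open>The Brouwer degree \<open>deg(F, B(u,r), 0)\<close> of a map \<open>F\<close> from \<open>E\<close> to its dual that has no zero on
  the boundary of the ball: the degree of the normalised boundary map. A change of the orthonormal
  basis conjugates the boundary map by an orthogonal map, so the degree does not depend on the basis.
  The unit sphere of \<open>E\<close> is \<open>nsphere (dim E - 1)\<close>; the only map of the zero space has degree 1.\<close>

definition ball_degree ::
    "'a::euclidean_space set \<Rightarrow> ('a \<Rightarrow> 'a \<Rightarrow>\<^sub>L real) \<Rightarrow> 'a \<Rightarrow> real \<Rightarrow> int" where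
  "ball_degree E F u r =
     (if dim E = 0 then 1
      else THE d. \<forall>b. orthonormal_frame E b \<longrightarrow> Brouwer_degree2 (dim E - 1) (sphere_map E b F u r) = d)"

definition isolated_zero ::
    "'a::euclidean_space set \<Rightarrow> ('a \<Rightarrow> 'a \<Rightarrow>\<^sub>L real) \<Rightarrow> 'a \<Rightarrow> bool" where
  "isolated_zero E F u \<longleftrightarrow>
     u \<in> E \<and> F u = 0 \<and> (\<exists>r>0. \<forall>x \<in> ball u r \<inter> E. F x = 0 \<longrightarrow> x = u)"

definition zero_index ::
    "'a::euclidean_space set \<Rightarrow> ('a \<Rightarrow> 'a \<Rightarrow>\<^sub>L real) \<Rightarrow> 'a \<Rightarrow> int" where
  "zero_index E F u = (THE d. \<forall>\<^sub>F r in at_right 0. ball_degree E F u r = d)"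

end

theory Submission
  imports Defs
begin

text \<open>
  Strong monotonicity turns both claims into statements about maps that point outward.

  Existence. Since \<open>A1 t1 = 0\<close>, the number \<open>L0 * \<kappa>\<close> is the norm of \<open>A0 t0\<close> on \<open>V0\<close> (if \<open>V0 \<noteq> {0}\<close>), and
  the smallness of \<open>\<kappa>\<close> says that it is less than \<open>\<delta> * C0\<close>. Hence there is a radius \<open>0 < r < \<delta>\<close> with
  \<open>L0 * \<kappa> < C0 * r\<close>, and for \<open>t\<close> on the sphere of radius \<open>r\<close> about \<open>t0\<close> in \<open>V0\<close>, strong monotonicity
  bounds \<open>A0 t (t - t0)\<close> from below by \<open>C0 * r\<^sup>2 + A0 t0 (t - t0) \<ge> (C0 * r - L0 * \<kappa>) * r > 0\<close>.
  A continuous map into the dual that points outward on a sphere has a zero inside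
  (\<open>outward_imp_zero\<close>, a consequence of Brouwer's fixed point theorem). Strong monotonicity makes the
  zero unique.

  Index. If \<open>F\<close> satisfies \<open>F x (x - u) > 0\<close> for all \<open>x \<noteq> u\<close> near \<open>u\<close> in its domain, then the segment from the
  normalised boundary map to the identity avoids the origin, so the index of \<open>F\<close> at \<open>u\<close> is 1
  (\<open>zero_index_outward\<close>). For \<open>A0\<close> at its zero \<open>s0\<close> this inequality is strong monotonicity. For the
  homotopy at parameter 0 the pairing with \<open>t - s1\<close> splits orthogonally into
  \<open>A0 (P t) (P t - s0)\<close>, where \<open>P\<close> is the projection to \<open>V0\<close>, and \<open>C0\<close> times the squared norm of
  \<open>(t - P t) - tp\<close>; so, near \<open>s1\<close>, it is at least \<open>C0 * (norm (t - s1))\<^sup>2\<close>. Both indices are therefore 1.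
\<close>

section \<open>Orthogonal projections and orthonormal frames\<close>

lemma orth_proj_unique:
  assumes E: "subspace E" and y: "y \<in> E" "t - y \<in> E\<^sup>\<bottom>"
  shows "orth_proj E t = y"
  unfolding orth_proj_def
proof (rule the_equality)
  show "y \<in> E \<and> t - y \<in> E\<^sup>\<bottom>"
    using y by simp
  fix z assume z: "z \<in> E \<and> t - z \<in> E\<^sup>\<bottom>"
  have "z - y \<in> E"
    using E y z by (simp add: subspace_diff)
  moreover have "(t - y) - (t - z) \<in> E\<^sup>\<bottom>"
    using subspace_diff[OF subspace_orthogonal_comp] y z by blast
  ultimately have "orthogonal (z - y) (z - y)"
    by (simp add: orthogonal_comp_def)
  then show "z = y"
    by (simp add: orthogonal_self)
qed

lemma
  assumes E: "subspace E"
  shows orth_proj_in: "orth_proj E t \<in> E"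
    and orth_proj_diff: "t - orth_proj E t \<in> E\<^sup>\<bottom>"
proof -
  obtain y z where "y \<in> E" "z \<in> E\<^sup>\<bottom>" "t = y + z"
    using subspace_sum_orthogonal_comp[OF E] by (metis UNIV_I set_plus_elim)
  then show "orth_proj E t \<in> E" "t - orth_proj E t \<in> E\<^sup>\<bottom>"
    using orth_proj_unique[OF E, of y t] by auto
qed

lemma linear_orth_proj:
  assumes E: "subspace E"
  shows "linear (orth_proj E)"
proof (rule linearI)
  note in_diff = orth_proj_in[OF E] orth_proj_diff[OF E]
  fix s t :: 'a and c :: real
  have "(s + t) - (orth_proj E s + orth_proj E t) = (s - orth_proj E s) + (t - orth_proj E t)"
    by simp
  then show "orth_proj E (s + t) = orth_proj E s + orth_proj E t"
    using in_diff subspace_add[OF E] subspace_add[OF subspace_orthogonal_comp]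
    by (metis orth_proj_unique[OF E])
  have "c *\<^sub>R t - c *\<^sub>R orth_proj E t = c *\<^sub>R (t - orth_proj E t)"
    by (simp add: algebra_simps)
  then show "orth_proj E (c *\<^sub>R t) = c *\<^sub>R orth_proj E t"
    using in_diff subspace_scale[OF E] subspace_scale[OF subspace_orthogonal_comp]
    by (metis orth_proj_unique[OF E])
qed

lemma orth_proj_pythagoras:
  assumes E: "subspace E"
  shows "(norm t)\<^sup>2 = (norm (orth_proj E t))\<^sup>2 + (norm (t - orth_proj E t))\<^sup>2"
proof -
  have "orthogonal (orth_proj E t) (t - orth_proj E t)"
    using orth_proj_in[OF E] orth_proj_diff[OF E] by (auto simp: orthogonal_comp_def)
  from norm_add_Pythagorean[OF this] show ?thesis
    by simp
qed

lemma norm_orth_proj_le: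
  assumes "subspace E"
  shows "norm (orth_proj E t) \<le> norm t"
  using orth_proj_pythagoras[OF assms, of t] by (simp add: power2_le_imp_le)

lemma orthonormal_frame_exists:
  fixes E :: "'a::euclidean_space set"
  assumes "subspace E"
  obtains b where "orthonormal_frame E b"
proof -
  obtain B where B: "pairwise orthogonal B" "\<And>x. x \<in> B \<Longrightarrow> norm x = 1" "independent B"
      "card B = dim E" "span B = E"
    using orthonormal_basis_subspace[OF assms] by metis
  then have "finite B"
    by (simp add: independent_imp_finite)
  then obtain b where b: "bij_betw b {..<dim E} B"
    using B(4) by (metis ex_bij_betw_nat_finite lessThan_atLeast0)
  have "inner (b i) (b j) = (if i = j then 1 else 0)" if "i < dim E" "j < dim E" for i j
  proof (cases "i = j")
    case True
    then show ?thesis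
      using B(2)[of "b i"] bij_betwE[OF b] that by (simp add: norm_eq_1)
  next
    case False
    then have "b i \<noteq> b j"
      using b that by (meson bij_betw_imp_inj_on inj_onD lessThan_iff)
    then show ?thesis
      using False B(1) bij_betwE[OF b] that by (auto simp: pairwise_def orthogonal_def)
  qed
  then have "orthonormal_frame E b"
    using B(5) bij_betw_imp_surj_on[OF b] by (simp add: orthonormal_frame_def)
  then show thesis
    by (rule that)
qed

lemma orthonormal_frame_sum:
  assumes b: "orthonormal_frame E b"
  shows "(\<Sum>i<dim E. x i *\<^sub>R b i) \<in> E"
    and "(norm (\<Sum>i<dim E. x i *\<^sub>R b i))\<^sup>2 = (\<Sum>i<dim E. (x i)\<^sup>2)"
proof -
  have "span (b ` {..<dim E}) = E"
    using b by (simp add: orthonormal_frame_def)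
  moreover have "(\<Sum>i<dim E. x i *\<^sub>R b i) \<in> span (b ` {..<dim E})"
    by (intro span_sum span_scale span_base) auto
  ultimately show "(\<Sum>i<dim E. x i *\<^sub>R b i) \<in> E"
    by simp
  have "inner (\<Sum>i<dim E. x i *\<^sub>R b i) (\<Sum>j<dim E. x j *\<^sub>R b j)
      = (\<Sum>j<dim E. \<Sum>i<dim E. x j * (x i * inner (b i) (b j)))"
    by (simp add: inner_sum_left inner_sum_right sum_distrib_left)
  also have "\<dots> = (\<Sum>j<dim E. \<Sum>i<dim E. if i = j then x j * x i else 0)"
    using b by (intro sum.cong refl) (auto simp: orthonormal_frame_def)
  also have "\<dots> = (\<Sum>i<dim E. (x i)\<^sup>2)"
    by (simp add: power2_eq_square)
  finally show "(norm (\<Sum>i<dim E. x i *\<^sub>R b i))\<^sup>2 = (\<Sum>i<dim E. (x i)\<^sup>2)"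
    by (simp add: power2_norm_eq_inner)
qed


section \<open>Maps that point outward have degree one\<close>

text \<open>The segment from \<open>g x\<close> to \<open>x\<close> consists of vectors with positive inner product with \<open>x\<close>, so it
  misses the origin and can be normalised to a homotopy to the identity.\<close>

lemma Brouwer_degree2_outward:
  fixes g :: "(nat \<Rightarrow> real) \<Rightarrow> nat \<Rightarrow> real"
  assumes cont: "\<And>j. j \<le> p \<Longrightarrow> continuous_map (nsphere p) euclideanreal (\<lambda>x. g x j)"
    and out: "\<And>x. x \<in> topspace (nsphere p) \<Longrightarrow> (\<Sum>j\<le>p. g x j * x j) > 0"
  shows "Brouwer_degree2 p (\<lambda>x j. if j \<le> p then g x j / L2_set (g x) {..p} else 0) = 1"
proof -
  define h where "h = (\<lambda>(t::real, x::nat \<Rightarrow> real) j. (1 - t) * g x j + t * x j)"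
  define H where "H = (\<lambda>z j. if j \<le> p then h z j / L2_set (h z) {..p} else 0)"
  let ?X = "prod_topology (top_of_set {0..1::real}) (nsphere p)"
  have nonzero: "L2_set (h z) {..p} \<noteq> 0" if z: "z \<in> topspace ?X" for z
  proof
    assume "L2_set (h z) {..p} = 0"
    then have h0: "h z j = 0" if "j \<le> p" for j
      using that by (simp add: L2_set_eq_0_iff)
    obtain t x where tx: "z = (t, x)" "0 \<le> t" "t \<le> 1" "x \<in> topspace (nsphere p)"
      using z by (cases z) auto
    have sph: "(\<Sum>j\<le>p. (x j)\<^sup>2) = 1"
      using tx(4) by (simp add: nsphere)
    have "(\<Sum>j\<le>p. h z j * x j) = (\<Sum>j\<le>p. (1 - t) * (g x j * x j) + t * (x j)\<^sup>2)"
      by (intro sum.cong refl) (simp add: h_def tx(1) algebra_simps power2_eq_square)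
    also have "\<dots> = (1 - t) * (\<Sum>j\<le>p. g x j * x j) + t"
      by (simp add: sum.distrib sph flip: sum_distrib_left)
    also have "\<dots> > 0"
      using tx out[OF tx(4)] by (cases "t = 1") (auto intro: add_pos_nonneg)
    finally show False
      by (simp add: h0)
  qed
  have cont_h: "continuous_map ?X euclideanreal (\<lambda>z. h z j)" if "j \<le> p" for j
  proof -
    have "continuous_map ?X euclideanreal (\<lambda>z. fst z)"
      by (rule continuous_map_into_fulltopology[OF continuous_map_fst])
    moreover have "continuous_map ?X euclideanreal (\<lambda>z. g (snd z) j)"
      using continuous_map_compose[OF continuous_map_snd cont[OF that]] by (simp add: o_def)
    moreover have "continuous_map ?X euclideanreal (\<lambda>z. snd z j)"
      using continuous_map_compose[OF continuous_map_snd continuous_map_nsphere_projection]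
      by (simp add: o_def)
    ultimately show ?thesis
      unfolding h_def case_prod_unfold by (intro continuous_intros)
  qed
  have "continuous_map ?X (subtopology (powertop_real UNIV)
          {x. (\<Sum>i\<le>p. (x i)\<^sup>2) = 1 \<and> (\<forall>i>p. x i = 0)}) H"
    unfolding continuous_map_in_subtopology continuous_map_componentwise_UNIV
  proof (intro conjI allI)
    fix j
    have cont_L2: "continuous_map ?X euclideanreal (\<lambda>z. L2_set (h z) {..p})"
      unfolding L2_set_def using cont_h by (intro continuous_intros) auto
    show "continuous_map ?X euclideanreal (\<lambda>z. H z j)"
    proof (cases "j \<le> p")
      case True
      have "continuous_map ?X euclideanreal (\<lambda>z. h z j / L2_set (h z) {..p})"
        by (intro continuous_map_real_divide cont_h[OF True] cont_L2 nonzero)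
      then show ?thesis
        using True by (simp add: H_def)
    qed (simp add: H_def)
  next
    have "(\<Sum>j\<le>p. (H z j)\<^sup>2) = 1" if z: "z \<in> topspace ?X" for z
    proof -
      have "(\<Sum>j\<le>p. (H z j)\<^sup>2) = (\<Sum>j\<le>p. (h z j)\<^sup>2) / (L2_set (h z) {..p})\<^sup>2"
        by (simp add: H_def power_divide sum_divide_distrib)
      also have "(\<Sum>j\<le>p. (h z j)\<^sup>2) = (L2_set (h z) {..p})\<^sup>2"
        by (simp add: L2_set_def sum_nonneg)
      finally show ?thesis
        using nonzero[OF z] by simp
    qed
    then show "H \<in> topspace ?X \<rightarrow> {x. (\<Sum>i\<le>p. (x i)\<^sup>2) = 1 \<and> (\<forall>i>p. x i = 0)}"
      by (auto simp: H_def)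
  qed
  then have cont_H: "continuous_map ?X (nsphere p) H"
    by (simp only: nsphere[symmetric])
  have "homotopic_with (\<lambda>x. True) (nsphere p) (nsphere p)
          (\<lambda>x j. if j \<le> p then g x j / L2_set (g x) {..p} else 0) id"
  proof (rule homotopic_with[THEN iffD2], simp, rule exI[of _ H], intro conjI ballI)
    show "continuous_map ?X (nsphere p) H"
      by (rule cont_H)
    show "H (0, x) = (\<lambda>j. if j \<le> p then g x j / L2_set (g x) {..p} else 0)" for x
      by (simp add: H_def h_def cong: if_cong)
    show "H (1, x) = id x" if "x \<in> topspace (nsphere p)" for x
    proof -
      have "(\<Sum>j\<le>p. (x j)\<^sup>2) = 1" "\<forall>j>p. x j = 0"
        using that by (simp_all add: nsphere)
      then show ?thesis
        by (auto simp: H_def h_def L2_set_def fun_eq_iff)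
    qed
  qed simp
  then show ?thesis
    using Brouwer_degree2_homotopic by fastforce
qed

text \<open>In coordinates with respect to an orthonormal frame and its dual, the pairing \<open>F x (x - u)\<close> is \<open>r\<close>
  times the inner product of the boundary map before normalisation with the point of the unit
  sphere. All frames thus give degree 1, and one exists, so the description in \<open>ball_degree\<close> denotes 1.\<close>

lemma ball_degree_outward:
  fixes E :: "'a::euclidean_space set"
  assumes E: "subspace E" and u: "u \<in> E" and r: "r > 0"
    and cont: "\<And>v. continuous_on (sphere u r \<inter> E) (\<lambda>x. blinfun_apply (F x) v)"
    and out: "\<And>x. x \<in> sphere u r \<inter> E \<Longrightarrow> blinfun_apply (F x) (x - u) > 0"
  shows "ball_degree E F u r = 1"
proof (cases "dim E")
  case 0
  then show ?thesis
    by (simp add: ball_degree_def)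
next
  case (Suc p)
  have deg: "Brouwer_degree2 p (sphere_map E b F u r) = 1" if b: "orthonormal_frame E b" for b
  proof -
    define \<phi> where "\<phi> x = u + r *\<^sub>R (\<Sum>i\<le>p. x i *\<^sub>R b i)" for x :: "nat \<Rightarrow> real"
    note frame = orthonormal_frame_sum[OF b, unfolded Suc lessThan_Suc_atMost]
    have \<phi>_sphere: "\<phi> x \<in> sphere u r \<inter> E" if "x \<in> topspace (nsphere p)" for x
    proof -
      have "(norm (\<Sum>i\<le>p. x i *\<^sub>R b i))\<^sup>2 = 1"
        using that frame(2)[of x] by (simp add: nsphere)
      then have "norm (\<Sum>i\<le>p. x i *\<^sub>R b i) = 1"
        by (metis norm_ge_zero power2_eq_1_iff neg_0_le_iff_le not_one_le_zero)
      then show ?thesis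
        using r u frame(1)[of x] E by (simp add: \<phi>_def dist_norm subspace_add subspace_scale)
    qed
    have cont_\<phi>: "continuous_map (nsphere p) (top_of_set (sphere u r \<inter> E)) \<phi>"
      unfolding continuous_map_in_subtopology
    proof
      show "continuous_map (nsphere p) euclidean \<phi>"
      proof -
        have "continuous_map (nsphere p) euclidean (\<lambda>x. x i *\<^sub>R b i)" for i
          using continuous_map_compose[OF continuous_map_nsphere_projection,
              of euclidean "\<lambda>y. y *\<^sub>R b i" p i]
          by (simp add: o_def continuous_on_scaleR)
        then have "continuous_map (nsphere p) euclidean (\<lambda>x. \<Sum>i\<le>p. x i *\<^sub>R b i)"
          by (intro continuous_map_sum) auto
        from continuous_map_compose[OF this, of euclidean "\<lambda>y. u + r *\<^sub>R y"] show ?thesis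
          by (simp add: \<phi>_def[abs_def] o_def continuous_on_add continuous_on_scaleR)
      qed
      show "\<phi> \<in> topspace (nsphere p) \<rightarrow> sphere u r \<inter> E"
        using \<phi>_sphere by auto
    qed
    have "continuous_map (nsphere p) euclideanreal (\<lambda>x. blinfun_apply (F (\<phi> x)) (b j))" for j
    proof -
      have "continuous_map (top_of_set (sphere u r \<inter> E)) euclideanreal
              (\<lambda>y. blinfun_apply (F y) (b j))"
        using cont by (simp add: continuous_map_iff_continuous)
      from continuous_map_compose[OF cont_\<phi> this] show ?thesis
        by (simp add: o_def)
    qed
    moreover have "(\<Sum>j\<le>p. blinfun_apply (F (\<phi> x)) (b j) * x j) > 0"
      if "x \<in> topspace (nsphere p)" for x
    proof -
      have "blinfun_apply (F (\<phi> x)) (\<phi> x - u)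
          = r * (\<Sum>j\<le>p. blinfun_apply (F (\<phi> x)) (b j) * x j)"
        by (simp add: \<phi>_def blinfun.scaleR_right blinfun.sum_right mult.commute)
      then show ?thesis
        using out[OF \<phi>_sphere[OF that]] r by (simp add: zero_less_mult_iff)
    qed
    ultimately have "Brouwer_degree2 p (\<lambda>x j. if j \<le> p
        then blinfun_apply (F (\<phi> x)) (b j) / L2_set (\<lambda>j. blinfun_apply (F (\<phi> x)) (b j)) {..p}
        else 0) = 1"
      by (intro Brouwer_degree2_outward)
    moreover have "sphere_map E b F u r = (\<lambda>x j. if j \<le> p
        then blinfun_apply (F (\<phi> x)) (b j) / L2_set (\<lambda>j. blinfun_apply (F (\<phi> x)) (b j)) {..p}
        else 0)"
      by (simp add: sphere_map_def \<phi>_def Suc Let_def fun_eq_iff less_Suc_eq_le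
          lessThan_Suc_atMost)
    ultimately show ?thesis
      by simp
  qed
  obtain b where "orthonormal_frame E b"
    using orthonormal_frame_exists[OF E] .
  then have "(THE d. \<forall>b. orthonormal_frame E b \<longrightarrow>
      Brouwer_degree2 p (sphere_map E b F u r) = d) = 1"
    using deg by (intro the_equality) auto
  then show ?thesis
    by (simp add: ball_degree_def Suc)
qed

lemma zero_index_eqI:
  assumes "\<forall>\<^sub>F r in at_right 0. ball_degree E F u r = d"
  shows "zero_index E F u = d"
  unfolding zero_index_def
proof (rule the_equality[of _ d])
  fix d' assume "\<forall>\<^sub>F r in at_right 0. ball_degree E F u r = d'"
  with assms have "\<forall>\<^sub>F r in at_right (0::real). d' = d"
    by eventually_elim simp
  then show "d' = d"
    by simp
qed (rule assms)

lemma zero_index_outward: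
  fixes E :: "'a::euclidean_space set"
  assumes E: "subspace E" and u: "u \<in> E" and R: "R > 0"
    and cont: "\<And>v. continuous_on (ball u R \<inter> E) (\<lambda>x. blinfun_apply (F x) v)"
    and out: "\<And>x. x \<in> ball u R \<inter> E \<Longrightarrow> x \<noteq> u \<Longrightarrow> blinfun_apply (F x) (x - u) > 0"
  shows "zero_index E F u = 1"
proof (rule zero_index_eqI)
  have "ball_degree E F u r = 1" if r: "0 < r" "r < R" for r
  proof (rule ball_degree_outward[OF E u r(1)])
    have "sphere u r \<inter> E \<subseteq> ball u R \<inter> E"
      using r by auto
    then show "continuous_on (sphere u r \<inter> E) (\<lambda>x. blinfun_apply (F x) v)" for v
      using cont continuous_on_subset by blast
    show "blinfun_apply (F x) (x - u) > 0" if "x \<in> sphere u r \<inter> E" for x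
      using that r by (intro out) auto
  qed
  then show "\<forall>\<^sub>F r in at_right 0. ball_degree E F u r = 1"
    using R by (auto simp: eventually_at_right_field)
qed

lemma isolated_zero_outward:
  assumes "u \<in> E" "F u = 0" "R > 0"
    and out: "\<And>x. x \<in> ball u R \<inter> E \<Longrightarrow> x \<noteq> u \<Longrightarrow> blinfun_apply (F x) (x - u) > 0"
  shows "isolated_zero E F u"
  unfolding isolated_zero_def
proof (intro conjI exI[of _ R] ballI impI)
  fix x assume "x \<in> ball u R \<inter> E" "F x = 0"
  then show "x = u"
    using out[of x] by fastforce
qed (use assms in auto)


section \<open>Zeros of outward-pointing maps into the dual\<close>

text \<open>With \<open>f x\<close> the Riesz vector of \<open>F x\<close>, let \<open>x\<close> be a Brouwer fixed point of
  \<open>x \<mapsto> closest_point S (x - f x)\<close> on \<open>S = cball a r \<inter> E\<close>. The obtuse-angle property of the closest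
  point reads \<open>f x \<bullet> (y - x) \<ge> 0\<close> for all \<open>y \<in> S\<close>. Taking \<open>y = a\<close> rules out that \<open>x\<close> lies on the
  sphere, and a small step from \<open>x\<close> in direction \<open>- f x\<close> then shows \<open>f x = 0\<close>. The step stays in \<open>E\<close>
  because \<open>F x\<close> vanishes on the orthogonal complement.\<close>

lemma outward_imp_zero:
  fixes E :: "'a::euclidean_space set"
  assumes E: "subspace E" and a: "a \<in> E" and r: "r > 0"
    and cont: "\<And>v. continuous_on (cball a r \<inter> E) (\<lambda>x. blinfun_apply (F x) v)"
    and dual: "\<And>x. x \<in> E \<Longrightarrow> F x \<in> dual_space E"
    and out: "\<And>x. x \<in> sphere a r \<inter> E \<Longrightarrow> blinfun_apply (F x) (x - a) > 0"
  obtains x where "x \<in> ball a r \<inter> E" "F x = 0"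
proof -
  define S where "S = cball a r \<inter> E"
  define f where "f x = (\<Sum>b\<in>Basis. blinfun_apply (F x) b *\<^sub>R b)" for x
  have riesz: "inner (f x) v = blinfun_apply (F x) v" for x v
  proof -
    have "blinfun_apply (F x) v = blinfun_apply (F x) (\<Sum>b\<in>Basis. inner b v *\<^sub>R b)"
      using euclidean_representation[of v] by (simp add: inner_commute)
    also have "\<dots> = inner (f x) v"
      by (simp add: f_def blinfun.sum_right blinfun.scaleR_right inner_sum_left mult.commute)
    finally show ?thesis ..
  qed
  have f_in: "f x \<in> E" if "x \<in> E" for x
  proof -
    have "f x \<in> E\<^sup>\<bottom>\<^sup>\<bottom>"
      using dual[OF that] riesz[of x]
      by (auto simp: orthogonal_comp_def orthogonal_def dual_space_def inner_commute)
    then show ?thesis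
      using orthogonal_comp_self[OF E] by simp
  qed
  have S: "compact S" "convex S" "closed S" "a \<in> S"
    using E a r by (auto simp: S_def compact_Int_closed closed_subspace convex_Int subspace_imp_convex
        closed_Int)
  have "continuous_on S f"
    unfolding f_def S_def by (intro continuous_intros cont)
  then have "continuous_on S (\<lambda>x. closest_point S (x - f x))"
    using S by (intro continuous_on_compose2[OF continuous_on_closest_point[of S UNIV]]
        continuous_intros) auto
  moreover have "(\<lambda>x. closest_point S (x - f x)) \<in> S \<rightarrow> S"
    using S by (auto intro!: closest_point_in_set)
  ultimately obtain x where x: "x \<in> S" "closest_point S (x - f x) = x"
    using brouwer[of S] S by blast
  have var: "inner (f x) (y - x) \<ge> 0" if "y \<in> S" for y
    using closest_point_dot[OF S(2,3) that, of "x - f x"] x(2) by simp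
  have "blinfun_apply (F x) (x - a) \<le> 0"
    using var[OF S(4)] riesz[of x "x - a"] by (simp add: inner_diff_right)
  then have "dist a x \<noteq> r"
    using out[of x] x(1) by (auto simp: S_def)
  then have inner: "dist a x < r"
    using x(1) by (simp add: S_def)
  \<comment> \<open>A step length for which the displacement is at most the distance to the sphere; the summand 1
    avoids a division by zero.\<close>
  define \<epsilon> where "\<epsilon> = (r - dist a x) / (norm (f x) + 1)"
  have pos: "norm (f x) + 1 > 0"
    using norm_ge_zero[of "f x"] by linarith
  have \<epsilon>: "\<epsilon> > 0"
    using inner pos by (simp add: \<epsilon>_def)
  have "\<epsilon> * norm (f x) \<le> \<epsilon> * (norm (f x) + 1)"
    using \<epsilon> by simp
  also have "\<dots> = r - dist a x"
    using pos by (simp add: \<epsilon>_def)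
  finally have "dist a x + dist x (x - \<epsilon> *\<^sub>R f x) \<le> r"
    using \<epsilon> by (simp add: dist_norm)
  then have "dist a (x - \<epsilon> *\<^sub>R f x) \<le> r"
    using dist_triangle[of a "x - \<epsilon> *\<^sub>R f x" x] by linarith
  then have "x - \<epsilon> *\<^sub>R f x \<in> S"
    using x(1) f_in E by (simp add: S_def subspace_diff subspace_scale)
  from var[OF this] have "\<epsilon> * inner (f x) (f x) \<le> 0"
    by simp
  then have "f x = 0"
    using \<epsilon> by (metis inner_gt_zero_iff mult_pos_pos not_less)
  then have "F x = 0"
    using riesz[of x] by (intro blinfun_eqI) auto
  then show thesis
    using that[of x] x(1) inner by (auto simp: S_def)
qed


section \<open>Strong monotonicity and the linear homotopy\<close>

lemma strongly_monotone_onD: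
  assumes "strongly_monotone_on S F C" "t \<in> S" "s \<in> S"
  shows "blinfun_apply (F t) (t - s) - blinfun_apply (F s) (t - s) \<ge> C * (norm (t - s))\<^sup>2"
  using assms by (auto simp: strongly_monotone_on_def blinfun.diff_left)

lemma C1_on_imp_continuous_on:
  assumes "C1_on E F"
  shows "continuous_on E F"
  using assms unfolding C1_on_def by (auto intro: has_derivative_continuous_on)

lemma blinfun_ge_uminus_SUP:
  fixes f :: "'a::euclidean_space \<Rightarrow>\<^sub>L real"
  assumes E: "subspace E" and v: "v \<in> E"
  shows "blinfun_apply f v \<ge> - (SUP u \<in> {u \<in> E. norm u = 1}. blinfun_apply f u) * norm v"
proof (cases "v = 0")
  case False
  define u where "u = - (v /\<^sub>R norm v)"
  have u: "u \<in> {u \<in> E. norm u = 1}"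
    using False E v by (simp add: u_def subspace_neg subspace_scale)
  have "bdd_above (blinfun_apply f ` {u \<in> E. norm u = 1})"
  proof (rule bdd_aboveI2)
    fix w assume "w \<in> {u \<in> E. norm u = 1}"
    then show "blinfun_apply f w \<le> norm f"
      using norm_blinfun[of f w] by auto
  qed
  from cSUP_upper[OF u this]
  have "- blinfun_apply f v / norm v \<le> (SUP u \<in> {u \<in> E. norm u = 1}. blinfun_apply f u)"
    by (simp add: u_def blinfun.minus_right blinfun.scaleR_right divide_inverse_commute)
  then show ?thesis
    using False by (simp add: field_simps)
qed simp

lemma blinfun_apply_linear_homotopy_0:
  fixes V0 :: "'a::euclidean_space set"
  assumes "subspace V0"
  shows "blinfun_apply (linear_homotopy V0 A0 A1 \<alpha> u t 0) s
    = blinfun_apply (A0 (orth_proj V0 t)) (orth_proj V0 s)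
      + \<alpha> * inner (t - orth_proj V0 t - u) (s - orth_proj V0 s)"
proof -
  have P: "bounded_linear (orth_proj V0)"
    by (simp add: linear_orth_proj[OF assms] linear_conv_bounded_linear[symmetric])
  have "bounded_linear (\<lambda>s. blinfun_apply (A0 (orth_proj V0 t)) (orth_proj V0 s))"
    by (rule bounded_linear_compose[OF blinfun.bounded_linear_right P])
  moreover have "bounded_linear (\<lambda>s. \<alpha> * inner (t - orth_proj V0 t - u) (s - orth_proj V0 s))"
    by (intro bounded_linear_const_mult bounded_linear_inner_right_comp bounded_linear_sub
        bounded_linear_ident P)
  ultimately have "bounded_linear (\<lambda>s. blinfun_apply (A0 (orth_proj V0 t)) (orth_proj V0 s)
      + \<alpha> * inner (t - orth_proj V0 t - u) (s - orth_proj V0 s))"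
    by (rule bounded_linear_add)
  then show ?thesis
    by (simp add: linear_homotopy_def bounded_linear_Blinfun_apply)
qed

text \<open>The pairing splits orthogonally, and the factor \<open>C\<close> in front of the complementary part is the
  monotonicity constant, so the two lower bounds recombine by Pythagoras.\<close>

lemma linear_homotopy_0_coercive:
  fixes V0 :: "'a::euclidean_space set"
  assumes V0: "subspace V0" and s0: "s0 \<in> V0" and u: "u \<in> V0\<^sup>\<bottom>"
    and A0: "blinfun_apply (A0 (orth_proj V0 t)) (orth_proj V0 t - s0)
      \<ge> C * (norm (orth_proj V0 t - s0))\<^sup>2"
  shows "blinfun_apply (linear_homotopy V0 A0 A1 C u t 0) (t - (s0 + u))
    \<ge> C * (norm (t - (s0 + u)))\<^sup>2"
proof -
  let ?P = "orth_proj V0"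
  have "?P (s0 + u) = s0"
    using s0 u by (intro orth_proj_unique[OF V0]) auto
  then have P: "?P (t - (s0 + u)) = ?P t - s0"
    by (simp add: linear_diff[OF linear_orth_proj[OF V0]])
  have diff: "t - (s0 + u) - (?P t - s0) = t - ?P t - u"
    by simp
  have "C * (norm (t - (s0 + u)))\<^sup>2
      = C * (norm (?P t - s0))\<^sup>2 + C * inner (t - ?P t - u) (t - ?P t - u)"
    unfolding orth_proj_pythagoras[OF V0, of "t - (s0 + u)"] P diff
    by (simp only: power2_norm_eq_inner ring_distribs)
  then show ?thesis
    using A0 unfolding blinfun_apply_linear_homotopy_0[OF V0] P diff by linarith
qed


section \<open>The zero near the projected solution and its index\<close>

theorem theorem4p31:
  fixes V0 :: "'a::euclidean_space set"
    and A0 A1 :: "'a \<Rightarrow> 'a \<Rightarrow>\<^sub>L real"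
    and t1 t0 tp :: 'a
    and \<kappa> L0 \<delta>0 \<delta>1 \<delta> C0 C1 :: real
  assumes V0: "subspace V0"
    and A0_dual: "\<And>t. t \<in> V0 \<Longrightarrow> A0 t \<in> dual_space V0"
    and zero: "A1 t1 = 0"
    and t0: "t0 = orth_proj V0 t1"
    and tp: "tp = t1 - t0"
    and kappa: "\<kappa> = norm tp"
    and C1_0: "C1_on V0 A0"
    and C1_1: "C1_on UNIV A1"
    and L0: "L0 * \<kappa> = (SUP u \<in> {u \<in> V0. norm u = 1}. blinfun_apply (A0 t0 - A1 t1) u)"
    and radii: "\<delta>0 > 0" "\<delta>1 > 0"
    and SM_pos: "C0 > 0" "C1 > 0"
    and SM0: "strongly_monotone_on (ball t0 \<delta>0 \<inter> V0) A0 C0"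
    and SM1: "strongly_monotone_on (ball t1 \<delta>1) A1 C1"
    and delta: "\<delta> = min \<delta>0 \<delta>1"
    and small: "L0 = 0 \<or> \<kappa> < \<delta> * (C0 / L0)"
  shows "(\<exists>!s0. s0 \<in> ball t0 \<delta> \<inter> V0 \<and> A0 s0 = 0) \<and>
         (\<forall>s0. s0 \<in> ball t0 \<delta> \<inter> V0 \<and> A0 s0 = 0 \<longrightarrow>
            (let s1 = s0 + tp; K = linear_homotopy V0 A0 A1 C0 tp in
               isolated_zero UNIV (\<lambda>t. K t 0) s1 \<and>
               isolated_zero V0 A0 s0 \<and>
               zero_index UNIV (\<lambda>t. K t 0) s1 = zero_index V0 A0 s0 \<and>
               zero_index V0 A0 s0 = 1))"
proof -
  have t0_in: "t0 \<in> V0" and tp_perp: "tp \<in> V0\<^sup>\<bottom>"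
    using orth_proj_in[OF V0] orth_proj_diff[OF V0] t0 tp by auto
  have \<delta>: "\<delta> > 0"
    using radii delta by simp
  have mono: "blinfun_apply (A0 t) (t - s) - blinfun_apply (A0 s) (t - s) \<ge> C0 * (norm (t - s))\<^sup>2"
    if "t \<in> ball t0 \<delta> \<inter> V0" "s \<in> ball t0 \<delta> \<inter> V0" for t s
    using that delta by (intro strongly_monotone_onD[OF SM0]) auto
  have cont: "continuous_on S (\<lambda>x. blinfun_apply (A0 x) v)" if "S \<subseteq> V0" for S v
    using continuous_on_subset[OF C1_on_imp_continuous_on[OF C1_0] that]
    by (intro continuous_intros)
  have lower: "blinfun_apply (A0 t0) v \<ge> - (L0 * \<kappa>) * norm v" if "v \<in> V0" for v
    using blinfun_ge_uminus_SUP[OF V0 that, of "A0 t0"] L0 zero by simp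

  have "L0 * \<kappa> < \<delta> * C0"
  proof (cases "L0 > 0")
    case True
    then show ?thesis
      using small by (simp add: field_simps)
  next
    case False
    then have "L0 * \<kappa> \<le> 0"
      using kappa by (simp add: mult_nonpos_nonneg)
    then show ?thesis
      using \<delta> SM_pos(1) by (smt (verit) mult_pos_pos)
  qed
  \<comment> \<open>The maximum with 0 makes \<open>r\<close> positive also when \<open>L0 * \<kappa>\<close> is not.\<close>
  then have "max 0 (L0 * \<kappa> / C0) < \<delta>"
    using \<delta> SM_pos(1) by (simp add: field_simps)
  then obtain r where "max 0 (L0 * \<kappa> / C0) < r" and r\<delta>: "r < \<delta>"
    using dense by blast
  then have r: "r > 0" "L0 * \<kappa> < C0 * r"
    using SM_pos(1) by (simp_all add: field_simps)
  obtain z where z: "z \<in> ball t0 r \<inter> V0" "A0 z = 0"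
  proof (rule outward_imp_zero[OF V0 t0_in r(1)])
    show "continuous_on (cball t0 r \<inter> V0) (\<lambda>x. blinfun_apply (A0 x) v)" for v
      by (rule cont) simp
    show "A0 x \<in> dual_space V0" if "x \<in> V0" for x
      using that by (rule A0_dual)
    fix x assume x: "x \<in> sphere t0 r \<inter> V0"
    have xV: "x - t0 \<in> V0"
      using x t0_in V0 by (simp add: subspace_diff)
    have nx: "norm (x - t0) = r"
      using x by (simp add: dist_norm norm_minus_commute)
    have "blinfun_apply (A0 x) (x - t0) - blinfun_apply (A0 t0) (x - t0) \<ge> C0 * r\<^sup>2"
      using mono[of x t0] x r\<delta> \<delta> t0_in nx by simp
    moreover have "blinfun_apply (A0 t0) (x - t0) \<ge> - (L0 * \<kappa>) * r"
      using lower[OF xV] nx by simp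
    moreover have "(C0 * r - L0 * \<kappa>) * r > 0"
      using r by simp
    ultimately show "blinfun_apply (A0 x) (x - t0) > 0"
      by (simp add: algebra_simps power2_eq_square)
  qed
  have z_in: "z \<in> ball t0 \<delta> \<inter> V0"
    using z(1) r\<delta> by auto
  have ex1: "\<exists>!s0. s0 \<in> ball t0 \<delta> \<inter> V0 \<and> A0 s0 = 0"
  proof (rule ex1I[of _ z])
    show "z \<in> ball t0 \<delta> \<inter> V0 \<and> A0 z = 0"
      using z_in z(2) by simp
    fix y assume "y \<in> ball t0 \<delta> \<inter> V0 \<and> A0 y = 0"
    then have "C0 * (norm (y - z))\<^sup>2 \<le> 0"
      using mono[of y z] z_in z(2) by simp
    then show "y = z"
      using SM_pos(1) by (simp add: mult_le_0_iff)
  qed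

  have index: "let s1 = s0 + tp; K = linear_homotopy V0 A0 A1 C0 tp in
               isolated_zero UNIV (\<lambda>t. K t 0) s1 \<and>
               isolated_zero V0 A0 s0 \<and>
               zero_index UNIV (\<lambda>t. K t 0) s1 = zero_index V0 A0 s0 \<and>
               zero_index V0 A0 s0 = 1"
    if s0: "s0 \<in> ball t0 \<delta> \<inter> V0 \<and> A0 s0 = 0" for s0
  proof -
    let ?P = "orth_proj V0"
    define K where "K t = linear_homotopy V0 A0 A1 C0 tp t 0" for t
    define s1 where "s1 = s0 + tp"
    \<comment> \<open>The ball of radius \<open>R\<close> about \<open>s0\<close> lies in the region of monotonicity. The same radius serves at
      \<open>s1\<close>, since the projection is nonexpansive and maps \<open>s1\<close> to \<open>s0\<close>.\<close>
    define R where "R = \<delta> - dist t0 s0"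
    have R: "R > 0"
      using s0 by (simp add: R_def)
    have ball_sub: "x \<in> ball t0 \<delta>" if "dist s0 x < R" for x
      using that dist_triangle[of t0 x s0] by (simp add: R_def)
    have A0_ge: "blinfun_apply (A0 x) (x - s0) \<ge> C0 * (norm (x - s0))\<^sup>2"
      if "x \<in> V0" "dist s0 x < R" for x
      using mono[of x s0] ball_sub[OF that(2)] that(1) s0 by simp
    have out_A0: "blinfun_apply (A0 x) (x - s0) > 0" if "x \<in> ball s0 R \<inter> V0" "x \<noteq> s0" for x
    proof -
      have "C0 * (norm (x - s0))\<^sup>2 > 0"
        using SM_pos(1) that(2) by simp
      then show ?thesis
        using A0_ge[of x] that(1) by simp
    qed

    have P_s1: "?P s1 = s0"
      using s0 tp_perp by (intro orth_proj_unique[OF V0]) (auto simp: s1_def)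
    have out_K: "blinfun_apply (K x) (x - s1) > 0" if "x \<in> ball s1 R \<inter> UNIV" "x \<noteq> s1" for x
    proof -
      have "?P s1 - ?P x = ?P (s1 - x)"
        by (simp add: linear_diff[OF linear_orth_proj[OF V0]])
      then have "dist s0 (?P x) \<le> dist s1 x"
        using norm_orth_proj_le[OF V0, of "s1 - x"] P_s1 by (simp add: dist_norm)
      then have "C0 * (norm (?P x - s0))\<^sup>2 \<le> blinfun_apply (A0 (?P x)) (?P x - s0)"
        using that(1) by (intro A0_ge orth_proj_in[OF V0]) simp
      then have "C0 * (norm (x - s1))\<^sup>2 \<le> blinfun_apply (K x) (x - s1)"
        unfolding K_def s1_def
        using s0 tp_perp by (intro linear_homotopy_0_coercive[OF V0]) auto
      moreover have "C0 * (norm (x - s1))\<^sup>2 > 0"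
        using SM_pos(1) that(2) by simp
      ultimately show ?thesis
        by linarith
    qed
    have K_zero: "K s1 = 0"
      using s0 by (intro blinfun_eqI)
        (simp add: K_def blinfun_apply_linear_homotopy_0[OF V0] P_s1, simp add: s1_def)
    have cont_P: "continuous_on S ?P" for S
      by (simp add: linear_continuous_on linear_orth_proj[OF V0] linear_conv_bounded_linear[symmetric])
    have cont_K: "continuous_on S (\<lambda>x. blinfun_apply (K x) v)" for S v
    proof -
      have "continuous_on S (\<lambda>x. blinfun_apply (A0 (?P x)) (?P v))"
        by (rule continuous_on_compose2[OF cont[OF order_refl] cont_P])
          (auto intro: orth_proj_in[OF V0])
      then show ?thesis
        unfolding K_def blinfun_apply_linear_homotopy_0[OF V0]
        by (rule continuous_on_add) (intro continuous_intros cont_P)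
    qed

    have "isolated_zero V0 A0 s0" "zero_index V0 A0 s0 = 1"
      using s0 R out_A0 V0 cont by (auto intro!: isolated_zero_outward zero_index_outward)
    moreover have "isolated_zero UNIV K s1"
      using K_zero R out_K by (intro isolated_zero_outward) auto
    moreover have "zero_index UNIV K s1 = 1"
      using R out_K cont_K by (intro zero_index_outward) auto
    ultimately show ?thesis
      by (simp add: K_def[abs_def] s1_def Let_def)
  qed
  show ?thesis
    using ex1 index by blast
qed

end
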